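(* Let $\mathcal{H}=(V,\mathcal{E})$ be an $S(2,l,n)$ Steiner system, i.e. $|V|=n$, $\mathcal{E}$ is a family of $l$-subsets of $V$ and every pair of vertices is contained in exactly one member of $\mathcal{E}$ (so $m=|\mathcal{E}|=\binom{n}{2}/\binom{l}{2}$); write $\mathcal{E}=\{E_1,\dots,E_m\}$. Let $k\ge 3$, and for each $i=1,\dots,m$ let $\mathcal{F}_i=(E_i,\mathcal{E}_i)$ be a $k$-uniform hypergraph on vertex set $E_i$. (1) If there is a real number $\alpha$ with $|\mathcal{E}_i|=\alpha\binom{l}{2}$ for all $i$, then $\left|\bigcup_{i=1}^m\mathcal{E}_i\right|=\alpha\binom{n}{2}$. (2) If every $\mathcal{F}_i$ is an edge-minimal hypertree, then $\mathcal{F}=\left(V,\bigcup_{i=1}^m\mathcal{E}_i\right)$ is also an edge-minimal hypertree.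
   Context: A $k$-uniform hypergraph $\mathcal{H}=(V,\mathcal{E})$ consists of a finite vertex set $V$ and a set $\mathcal{E}$ of $k$-element subsets of $V$ (no multiple edges). A $k$-uniform hypergraph is a chain if there is a sequence $v_1,\dots,v_l$ of its vertices in which every vertex appears at least once (possibly more times), $v_1\ne v_l$, and its edge set consists of exactly the $l-k+1$ distinct sets $\{v_i,\dots,v_{i+k-1}\}$, $1\le i\le l-k+1$; it is a semicycle if the same holds with $v_1=v_l$ instead. $\mathcal{H}$ is chain-connected if every pair of distinct vertices is contained in some subhypergraph that is a chain; semicycle-free if no subhypergraph is a semicycle. A hypertree is a chain-connected, semicycle-free $k$-uniform hypergraph. An edge-minimal hypertree is a hypertree $(V,\mathcal{E})$ such that for every $e\in\mathcal{E}$, $(V,\mathcal{E}\setminus\{e\})$ is not a hypertree. *)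

theory Defs
  imports Complex_Main
begin

definition uniform_hypergraph :: "nat \<Rightarrow> 'a set \<Rightarrow> 'a set set \<Rightarrow> bool" where
  "uniform_hypergraph k V E \<longleftrightarrow> finite V \<and> (\<forall>e\<in>E. e \<subseteq> V \<and> card e = k)"

definition window :: "nat \<Rightarrow> 'a list \<Rightarrow> nat \<Rightarrow> 'a set" where
  "window k vs i = (\<lambda>j. vs ! j) ` {i..<i + k}"

text \<open>
  The sequence \<open>vs\<close> of length \<open>l\<close> lists all vertices, and the edges are exactly its
  \<open>l - k + 1\<close> windows of \<open>k\<close> consecutive entries (positions are counted from 0), which are
  pairwise distinct. The condition \<open>k \<le> length vs\<close> says that there is at least one window;
  without it a short sequence would be an edgeless chain or semicycle.
\<close>

definition window_sequence :: "nat \<Rightarrow> 'a set \<Rightarrow> 'a set set \<Rightarrow> 'a list \<Rightarrow> bool" where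
  "window_sequence k V E vs \<longleftrightarrow>
     set vs = V \<and> k \<le> length vs \<and>
     E = window k vs ` {0..length vs - k} \<and>
     inj_on (window k vs) {0..length vs - k}"

definition chain :: "nat \<Rightarrow> 'a set \<Rightarrow> 'a set set \<Rightarrow> bool" where
  "chain k V E \<longleftrightarrow>
     uniform_hypergraph k V E \<and> (\<exists>vs. window_sequence k V E vs \<and> hd vs \<noteq> last vs)"

definition semicycle :: "nat \<Rightarrow> 'a set \<Rightarrow> 'a set set \<Rightarrow> bool" where
  "semicycle k V E \<longleftrightarrow>
     uniform_hypergraph k V E \<and> (\<exists>vs. window_sequence k V E vs \<and> hd vs = last vs)"

text \<open>Subhypergraphs need not be induced.\<close>

definition subhypergraph :: "'a set \<Rightarrow> 'a set set \<Rightarrow> 'a set \<Rightarrow> 'a set set \<Rightarrow> bool" where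
  "subhypergraph V' E' V E \<longleftrightarrow> V' \<subseteq> V \<and> E' \<subseteq> E \<and> (\<forall>e\<in>E'. e \<subseteq> V')"

definition chain_connected :: "nat \<Rightarrow> 'a set \<Rightarrow> 'a set set \<Rightarrow> bool" where
  "chain_connected k V E \<longleftrightarrow>
     (\<forall>u\<in>V. \<forall>v\<in>V. u \<noteq> v \<longrightarrow>
        (\<exists>V' E'. subhypergraph V' E' V E \<and> chain k V' E' \<and> u \<in> V' \<and> v \<in> V'))"

definition semicycle_free :: "nat \<Rightarrow> 'a set \<Rightarrow> 'a set set \<Rightarrow> bool" where
  "semicycle_free k V E \<longleftrightarrow>
     \<not> (\<exists>V' E'. subhypergraph V' E' V E \<and> semicycle k V' E')"

definition hypertree :: "nat \<Rightarrow> 'a set \<Rightarrow> 'a set set \<Rightarrow> bool" where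
  "hypertree k V E \<longleftrightarrow>
     uniform_hypergraph k V E \<and> chain_connected k V E \<and> semicycle_free k V E"

definition edge_minimal_hypertree :: "nat \<Rightarrow> 'a set \<Rightarrow> 'a set set \<Rightarrow> bool" where
  "edge_minimal_hypertree k V E \<longleftrightarrow>
     hypertree k V E \<and> (\<forall>e\<in>E. \<not> hypertree k V (E - {e}))"

definition steiner_system :: "nat \<Rightarrow> nat \<Rightarrow> nat \<Rightarrow> 'a set \<Rightarrow> 'a set set \<Rightarrow> bool" where
  "steiner_system t l n V \<B> \<longleftrightarrow>
     finite V \<and> card V = n \<and>
     (\<forall>B\<in>\<B>. B \<subseteq> V \<and> card B = l) \<and>
     (\<forall>T. T \<subseteq> V \<and> card T = t \<longrightarrow> (\<exists>!B. B \<in> \<B> \<and> T \<subseteq> B))"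

end

theory Submission
  imports Defs "HOL-Library.Disjoint_Sets"
begin

text \<open>
  Consecutive windows of a chain or semicycle share \<open>k - 1 \<ge> 2\<close> vertices, and two blocks share at
  most one, so every chain or semicycle of the union lives inside a single block. Hence semicycles
  of the union, and chains of the union avoiding an edge, are already present in some \<open>F i\<close>.
  The same principle makes the \<open>F i\<close> disjoint, and the first part follows by double counting pairs.
\<close>

text \<open>The block of the first window is propagated along the sequence by induction:
  neighbouring windows share two distinct vertices, and these determine the block. Working with
  \<open>window_sequence\<close> rather than \<open>chain\<close> or \<open>semicycle\<close> lets
  one argument serve both, since the end condition is irrelevant to it.\<close>

lemma window_sequence_in_one_block:
  assumes k: "k \<ge> 3"
    and blocks: "\<And>i j x y. \<lbrakk>i \<in> I; j \<in> I; x \<noteq> y; {x, y} \<subseteq> B i; {x, y} \<subseteq> B j\<rbrakk> \<Longrightarrow> i = j"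
    and uniform: "\<And>i. i \<in> I \<Longrightarrow> uniform_hypergraph k (B i) (F i)"
    and seq: "window_sequence k V' E' vs"
    and sub: "E' \<subseteq> (\<Union>i\<in>I. F i)"
  obtains i where "i \<in> I" "E' \<subseteq> F i" "V' \<subseteq> B i"
proof -
  let ?N = "length vs - k"
  have V': "V' = set vs" and len: "k \<le> length vs" and E': "E' = window k vs ` {0..?N}"
    using seq by (auto simp: window_sequence_def)
  have in_F: "\<exists>i\<in>I. window k vs p \<in> F i" if "p \<le> ?N" for p
    using subsetD[OF sub, of "window k vs p"] that unfolding E' by auto
  have edge: "e \<subseteq> B i" "card e = k" if "i \<in> I" "e \<in> F i" for i e
    using uniform that by (auto simp: uniform_hypergraph_def)
  \<comment> \<open>Entries may repeat along the sequence, but not inside one window: it is an edge,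
    so \<open>k\<close> positions yield \<open>k\<close> vertices.\<close>
  have inj: "inj_on ((!) vs) {p..<p + k}" if "p \<le> ?N" for p
  proof -
    have "card (window k vs p) = k"
      using in_F[OF that] edge(2) by blast
    then show ?thesis
      by (intro eq_card_imp_inj_on) (auto simp: window_def)
  qed
  obtain i where i: "i \<in> I" "window k vs 0 \<in> F i"
    using in_F[of 0] by auto
  have all: "window k vs p \<in> F i" if "p \<le> ?N" for p
    using that
  proof (induction p)
    case 0
    then show ?case using i by simp
  next
    case (Suc p)
    then have IH: "window k vs p \<in> F i" by simp
    obtain j where j: "j \<in> I" "window k vs (Suc p) \<in> F j"
      using in_F[OF Suc.prems] by auto
    \<comment> \<open>Window \<open>p\<close> ends at position \<open>p + k - 1\<close>, so
      \<open>k \<ge> 3\<close> is exactly what puts both positions into it; \<open>Suc p\<close> is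
      where the next window starts.\<close>
    let ?x = "vs ! Suc p" and ?y = "vs ! Suc (Suc p)"
    have "{?x, ?y} \<subseteq> window k vs p" "{?x, ?y} \<subseteq> window k vs (Suc p)"
      using k by (auto simp: window_def)
    then have "{?x, ?y} \<subseteq> B i" "{?x, ?y} \<subseteq> B j"
      using edge(1)[OF i(1) IH] edge(1)[OF j] by auto
    moreover have "?x \<noteq> ?y"
      using inj_onD[OF inj[OF Suc.prems], of "Suc p" "Suc (Suc p)"] k by auto
    ultimately have "i = j"
      using blocks i(1) j(1) by blast
    with j show ?case by simp
  qed
  have "V' \<subseteq> B i"
  proof
    fix x assume "x \<in> V'"
    then obtain q where q: "q < length vs" "x = vs ! q"
      unfolding V' by (auto simp: in_set_conv_nth)
    \<comment> \<open>Position \<open>q\<close> starts a window unless it is too close to the end;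
      then the last window, starting at \<open>?N\<close>, contains it.\<close>
    have "q \<in> {min q ?N..<min q ?N + k}"
      using q(1) len k by auto
    then have "x \<in> window k vs (min q ?N)"
      unfolding window_def q(2) by (rule imageI)
    then show "x \<in> B i"
      using all[of "min q ?N"] edge(1)[OF i(1)] by auto
  qed
  moreover have "E' \<subseteq> F i"
    using all unfolding E' by auto
  ultimately show thesis
    using that i(1) by blast
qed

text \<open>A common edge would contain two vertices, and these would lie in two different blocks.
  This turns the size of the union into a sum.\<close>

lemma disjoint_family_on_edges:
  assumes k: "k \<ge> 2"
    and blocks: "\<And>i j x y. \<lbrakk>i \<in> I; j \<in> I; x \<noteq> y; {x, y} \<subseteq> B i; {x, y} \<subseteq> B j\<rbrakk> \<Longrightarrow> i = j"
    and uniform: "\<And>i. i \<in> I \<Longrightarrow> uniform_hypergraph k (B i) (F i)"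
  shows "disjoint_family_on F I"
  unfolding disjoint_family_on_def
proof (intro ballI impI)
  fix i j assume ij: "i \<in> I" "j \<in> I" "i \<noteq> j"
  have False if "e \<in> F i" "e \<in> F j" for e
  proof -
    have e: "e \<subseteq> B i" "e \<subseteq> B j" "card e = k"
      using uniform ij that by (auto simp: uniform_hypergraph_def)
    obtain T where "T \<subseteq> e" "card T = 2"
      using obtain_subset_with_card_n[of 2 e] k e(3) by auto
    moreover from this obtain x y where "T = {x, y}" "x \<noteq> y"
      by (auto simp: card_2_iff)
    ultimately show False
      using blocks[of i j x y] ij e by auto
  qed
  then show "F i \<inter> F j = {}" by blast
qed

text \<open>The Steiner system enters only through \<open>cover\<close> and \<open>blocks\<close>:
  any two points lie in exactly one block, as in a finite linear space. Connectivity is inherited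
  from the block through the two points, and everything else from the confinement of window
  sequences to one block.\<close>

lemma edge_minimal_hypertree_Union_blocks:
  assumes k: "k \<ge> 3"
    and finite: "finite V"
    and subset: "\<And>i. i \<in> I \<Longrightarrow> B i \<subseteq> V"
    and cover: "\<And>x y. \<lbrakk>x \<in> V; y \<in> V; x \<noteq> y\<rbrakk> \<Longrightarrow> \<exists>i\<in>I. {x, y} \<subseteq> B i"
    and blocks: "\<And>i j x y. \<lbrakk>i \<in> I; j \<in> I; x \<noteq> y; {x, y} \<subseteq> B i; {x, y} \<subseteq> B j\<rbrakk> \<Longrightarrow> i = j"
    and minimal: "\<And>i. i \<in> I \<Longrightarrow> edge_minimal_hypertree k (B i) (F i)"
  shows "edge_minimal_hypertree k V (\<Union>i\<in>I. F i)"
proof -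
  have uniform: "uniform_hypergraph k (B i) (F i)"
    and connected: "chain_connected k (B i) (F i)"
    and free: "semicycle_free k (B i) (F i)" if "i \<in> I" for i
    using minimal[OF that] by (auto simp: edge_minimal_hypertree_def hypertree_def)
  have one_block: "\<exists>i\<in>I. E' \<subseteq> F i \<and> V' \<subseteq> B i"
    if "window_sequence k V' E' vs" "E' \<subseteq> (\<Union>i\<in>I. F i)" for V' E' vs
    by (rule window_sequence_in_one_block[where I = I and B = B and F = F, OF k _ uniform that])
      (use blocks in blast)+
  have "uniform_hypergraph k V (\<Union>i\<in>I. F i)"
    using finite subset uniform by (fastforce simp: uniform_hypergraph_def)
  moreover have "chain_connected k V (\<Union>i\<in>I. F i)"
    unfolding chain_connected_def
  proof (intro ballI impI)
    fix u v assume "u \<in> V" "v \<in> V" "u \<noteq> v"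
    with cover obtain i where i: "i \<in> I" "{u, v} \<subseteq> B i" by blast
    with connected \<open>u \<noteq> v\<close> obtain V' E' where
      "subhypergraph V' E' (B i) (F i)" "chain k V' E'" "u \<in> V'" "v \<in> V'"
      unfolding chain_connected_def by blast
    moreover from this have "subhypergraph V' E' V (\<Union>i\<in>I. F i)"
      using i(1) subset unfolding subhypergraph_def by blast
    ultimately show "\<exists>V' E'. subhypergraph V' E' V (\<Union>i\<in>I. F i) \<and> chain k V' E' \<and> u \<in> V' \<and> v \<in> V'"
      by blast
  qed
  moreover have "semicycle_free k V (\<Union>i\<in>I. F i)"
    unfolding semicycle_free_def
  proof clarify
    fix V' E' assume sub: "subhypergraph V' E' V (\<Union>i\<in>I. F i)" and semi: "semicycle k V' E'"
    obtain vs where "window_sequence k V' E' vs"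
      using semi by (auto simp: semicycle_def)
    moreover have "E' \<subseteq> (\<Union>i\<in>I. F i)"
      using sub by (simp add: subhypergraph_def)
    ultimately obtain i where "i \<in> I" "E' \<subseteq> F i" "V' \<subseteq> B i"
      using one_block by blast
    moreover from this have "subhypergraph V' E' (B i) (F i)"
      using sub by (simp add: subhypergraph_def)
    ultimately show False
      using free semi unfolding semicycle_free_def by blast
  qed
  moreover have "\<not> hypertree k V ((\<Union>i\<in>I. F i) - {e})" if e: "e \<in> (\<Union>i\<in>I. F i)" for e
  proof
    assume "hypertree k V ((\<Union>i\<in>I. F i) - {e})"
    then have conn: "chain_connected k V ((\<Union>i\<in>I. F i) - {e})"
      by (simp add: hypertree_def)
    obtain i where i: "i \<in> I" "e \<in> F i"
      using e by blast
    \<comment> \<open>Deleting an edge preserves uniformity and semicycle-freeness, so this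
      connectivity is all it takes to contradict the minimality of \<open>F i\<close>.\<close>
    have "chain_connected k (B i) (F i - {e})"
      unfolding chain_connected_def
    proof (intro ballI impI)
      fix u v assume uv: "u \<in> B i" "v \<in> B i" "u \<noteq> v"
      then have "u \<in> V" "v \<in> V"
        using subset[OF i(1)] by auto
      then obtain V' E' where sub: "subhypergraph V' E' V ((\<Union>i\<in>I. F i) - {e})"
        and chain: "chain k V' E'" and in_V': "u \<in> V'" "v \<in> V'"
        using conn uv(3) unfolding chain_connected_def by blast
      obtain vs where "window_sequence k V' E' vs"
        using chain by (auto simp: chain_def)
      moreover have "E' \<subseteq> (\<Union>i\<in>I. F i)"
        using sub by (auto simp: subhypergraph_def)
      ultimately obtain j where j: "j \<in> I" "E' \<subseteq> F j" "V' \<subseteq> B j"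
        using one_block by blast
      \<comment> \<open>The chain passes through \<open>u\<close> and \<open>v\<close>, so its block
        shares these two vertices with \<open>B i\<close>.\<close>
      then have "i = j"
        using blocks[of i j u v] uv i(1) in_V' by blast
      with j sub have "subhypergraph V' E' (B i) (F i - {e})"
        unfolding subhypergraph_def by blast
      with chain in_V'
      show "\<exists>V' E'. subhypergraph V' E' (B i) (F i - {e}) \<and> chain k V' E' \<and> u \<in> V' \<and> v \<in> V'"
        by blast
    qed
    moreover have "uniform_hypergraph k (B i) (F i - {e})"
      using uniform[OF i(1)] by (auto simp: uniform_hypergraph_def)
    moreover have "semicycle_free k (B i) (F i - {e})"
      using free[OF i(1)] unfolding semicycle_free_def subhypergraph_def by blast
    ultimately show False
      using minimal[OF i(1)] i(2) by (auto simp: edge_minimal_hypertree_def hypertree_def)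
  qed
  ultimately show ?thesis
    by (simp add: edge_minimal_hypertree_def hypertree_def)
qed

text \<open>Each 2-subset of \<open>V\<close> is counted once, in its unique block. The product form
  avoids dividing by \<open>l choose 2\<close>, which is 0 for \<open>l < 2\<close>.\<close>

lemma steiner_system_2_count:
  assumes steiner: "steiner_system 2 l n V \<E>"
  shows "card \<E> * (l choose 2) = n choose 2"
proof -
  let ?P = "\<lambda>B. {T. T \<subseteq> B \<and> card T = 2}"
  have finV: "finite V" and cardV: "card V = n"
    and block: "\<And>B. B \<in> \<E> \<Longrightarrow> B \<subseteq> V \<and> card B = l"
    and unique: "\<And>T. T \<subseteq> V \<Longrightarrow> card T = 2 \<Longrightarrow> \<exists>!B. B \<in> \<E> \<and> T \<subseteq> B"
    using steiner by (auto simp: steiner_system_def)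
  have "finite \<E>"
    using finV block by (auto intro: finite_subset[of _ "Pow V"])
  have finB: "finite B" if "B \<in> \<E>" for B
    using block[OF that] finV finite_subset by blast
  have "?P V = (\<Union>B\<in>\<E>. ?P B)"
  proof (intro equalityI subsetI)
    fix T assume "T \<in> ?P V"
    then show "T \<in> (\<Union>B\<in>\<E>. ?P B)"
      using unique[of T] by auto
  qed (use block in auto)
  then have "n choose 2 = card (\<Union>B\<in>\<E>. ?P B)"
    using n_subsets[OF finV, of 2] cardV by simp
  also have "\<dots> = (\<Sum>B\<in>\<E>. card (?P B))"
  proof (rule card_UN_disjoint)
    have "B = C" if "B \<in> \<E>" "C \<in> \<E>" "T \<in> ?P B" "T \<in> ?P C" for B C T
    proof -
      have "T \<subseteq> V" "card T = 2"
        using that block by auto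
      then show ?thesis
        using unique[of T] that by auto
    qed
    then show "\<forall>B\<in>\<E>. \<forall>C\<in>\<E>. B \<noteq> C \<longrightarrow> ?P B \<inter> ?P C = {}"
      by blast
  qed (use \<open>finite \<E>\<close> finB in auto)
  also have "\<dots> = (\<Sum>B\<in>\<E>. l choose 2)"
    by (intro sum.cong) (simp_all add: n_subsets finB block)
  finally show ?thesis by simp
qed

theorem theorem11:
  fixes V :: "'a set" and \<E> :: "'a set set"
    and l n m k :: nat
    and E :: "nat \<Rightarrow> 'a set" and F :: "nat \<Rightarrow> 'a set set"
  assumes steiner: "steiner_system 2 l n V \<E>"
    and blocks: "bij_betw E {1..m} \<E>"
    and k: "k \<ge> 3"
    and hypergraphs: "\<And>i. i \<in> {1..m} \<Longrightarrow> uniform_hypergraph k (E i) (F i)"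
  shows "(\<forall>\<alpha>::real.
            (\<forall>i\<in>{1..m}. real (card (F i)) = \<alpha> * real (l choose 2)) \<longrightarrow>
            real (card (\<Union>i\<in>{1..m}. F i)) = \<alpha> * real (n choose 2)) \<and>
         ((\<forall>i\<in>{1..m}. edge_minimal_hypertree k (E i) (F i)) \<longrightarrow>
            edge_minimal_hypertree k V (\<Union>i\<in>{1..m}. F i))"
proof (intro conjI allI impI)
  have E_in: "E i \<in> \<E>" if "i \<in> {1..m}" for i
    using bij_betwE[OF blocks] that by blast
  have finV: "finite V" and block: "\<And>i. i \<in> {1..m} \<Longrightarrow> E i \<subseteq> V"
    and unique: "\<And>T. T \<subseteq> V \<Longrightarrow> card T = 2 \<Longrightarrow> \<exists>!B. B \<in> \<E> \<and> T \<subseteq> B"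
    using steiner E_in unfolding steiner_system_def by blast+
  \<comment> \<open>The Steiner property identifies the blocks as sets; injectivity of
    \<open>E\<close> carries this over to the indices, by which the \<open>F i\<close> are
    labelled.\<close>
  have same_block: "i = j"
    if ij: "i \<in> {1..m}" "j \<in> {1..m}" and xy: "x \<noteq> y" "{x, y} \<subseteq> E i" "{x, y} \<subseteq> E j" for i j x y
  proof -
    have "{x, y} \<subseteq> V" "card {x, y} = 2"
      using xy block[OF ij(1)] by auto
    then have "E i = E j"
      using unique[of "{x, y}"] xy E_in[OF ij(1)] E_in[OF ij(2)] by blast
    then show ?thesis
      using inj_onD[OF bij_betw_imp_inj_on[OF blocks]] ij by blast
  qed
  have cover: "\<exists>i\<in>{1..m}. {x, y} \<subseteq> E i" if "x \<in> V" "y \<in> V" "x \<noteq> y" for x y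
  proof -
    have "{x, y} \<subseteq> V" "card {x, y} = 2"
      using that by auto
    then obtain B where "B \<in> \<E>" "{x, y} \<subseteq> B"
      using unique by blast
    then show ?thesis
      using bij_betw_imp_surj_on[OF blocks] by blast
  qed
  {
    fix \<alpha> :: real
    assume \<alpha>: "\<forall>i\<in>{1..m}. real (card (F i)) = \<alpha> * real (l choose 2)"
    have finF: "finite (F i)" if "i \<in> {1..m}" for i
      using hypergraphs[OF that] finite_subset[of "F i" "Pow (E i)"]
      by (auto simp: uniform_hypergraph_def)
    have "disjoint_family_on F {1..m}"
      by (rule disjoint_family_on_edges[where B = E and k = k])
        (use k same_block hypergraphs in \<open>simp, blast, blast\<close>)
    then have "card (\<Union>i\<in>{1..m}. F i) = (\<Sum>i\<in>{1..m}. card (F i))"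
      by (intro card_UN_disjoint) (simp_all add: finF disjoint_family_on_def)
    then have "real (card (\<Union>i\<in>{1..m}. F i)) = (\<Sum>i\<in>{1..m}. \<alpha> * real (l choose 2))"
      using \<alpha> by simp
    \<comment> \<open>Collecting the natural factors under one \<open>real\<close> lets the block
      count apply, with \<open>m = card \<E>\<close> from the bijection.\<close>
    also have "\<dots> = \<alpha> * real (m * (l choose 2))"
      by simp
    also have "m * (l choose 2) = n choose 2"
      using steiner_system_2_count[OF steiner] bij_betw_same_card[OF blocks] by simp
    finally show "real (card (\<Union>i\<in>{1..m}. F i)) = \<alpha> * real (n choose 2)" .
  }
  assume minimal: "\<forall>i\<in>{1..m}. edge_minimal_hypertree k (E i) (F i)"
  show "edge_minimal_hypertree k V (\<Union>i\<in>{1..m}. F i)"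
  proof (rule edge_minimal_hypertree_Union_blocks[where B = E])
    show "i = j"
      if "i \<in> {1..m}" "j \<in> {1..m}" "x \<noteq> y" "{x, y} \<subseteq> E i" "{x, y} \<subseteq> E j" for i j x y
      using that by (rule same_block)
  qed (use k finV block cover minimal in simp_all)
qed

end
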